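(* The Self-Crossing Index $\mathrm{SCI}$ is a Vassiliev (finite type) diagram invariant of order exactly $1$.
   Context: Knot diagrams are oriented diagrams in $\mathbb{R}^2$. For a diagram with underlying oriented curve $C$, the index of a region (component of $\mathbb{R}^2\setminus C$) is the winding number of $C$ around any of its points, and the index $\mathrm{ind}(c)$ of a crossing $c$ is the average of the indices of the four regions adjacent to $c$ (with multiplicity). $\mathrm{SCI}(D)=\sum_{c}\mathrm{sgn}(c)\,\mathrm{ind}(c)$, summing over all crossings $c$ of $D$, where $\mathrm{sgn}(c)$ is the sign of the crossing. Vassiliev diagram invariants. For a knot diagram invariant $I$ (with values in an abelian group), a diagram $D$ and a set $S$ of crossings of $D$, let $$I_S(D)=\sum_{X\subseteq S}(-1)^{|X|}I(D_X),$$ where $D_X$ is $D$ with all crossings in $X$ changed (over and under exchanged). $I$ is a Vassiliev invariant of order at most $m\ge0$ if $I_S(D)=0$ for every diagram $D$ and every set $S$ of crossings of $D$ with $|S|=m+1$. It is of order (exactly) $m$ if it is of order at most $m$ and there exist a diagram $D$ and a set $S$ of crossings of $D$ with $|S|=m$ and $I_S(D)\ne0$. *)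

theory Defs
  imports "HOL-Complex_Analysis.Complex_Analysis"
begin

text \<open>The plane is identified with \<^typ>\<open>complex\<close>.\<close>

definition smooth_map :: "(real \<Rightarrow> 'a::real_normed_vector) \<Rightarrow> bool" where
  "smooth_map f \<longleftrightarrow>
     (\<exists>F :: nat \<Rightarrow> real \<Rightarrow> 'a. F 0 = f \<and>
        (\<forall>n t. (F n has_vector_derivative F (Suc n) t) (at t)))"

definition cross2 :: "complex \<Rightarrow> complex \<Rightarrow> real" where
  "cross2 u v = Re u * Im v - Im u * Re v"


section \<open>Oriented knot diagrams in the plane\<close>

text \<open>
  The underlying oriented curve is given by a 1-periodic parametrization \<open>curve\<close>, so two
  parameters describe the same point of the circle iff their difference is an integer.  The
  crossing information is the (1-periodic) set \<open>over\<close> of those parameters at which the curve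
  passes through a crossing as the over strand.
\<close>

record diagram =
  curve :: "real \<Rightarrow> complex"
  over :: "real set"

definition image_curve :: "diagram \<Rightarrow> complex set" where
  "image_curve D = path_image (curve D)"

definition tangent :: "diagram \<Rightarrow> real \<Rightarrow> complex" where
  "tangent D t = vector_derivative (curve D) (at t)"

definition double_pair :: "diagram \<Rightarrow> real \<Rightarrow> real \<Rightarrow> bool" where
  "double_pair D s t \<longleftrightarrow> s - t \<notin> \<int> \<and> curve D s = curve D t"

definition crossings :: "diagram \<Rightarrow> complex set" where
  "crossings D = {c. \<exists>s t. double_pair D s t \<and> curve D s = c}"

text \<open>A generic smooth immersion of the circle (finitely many multiple points, all of them
  transverse double points), with one of the two strands at each crossing marked as the over
  strand.\<close>

definition knot_diagram :: "diagram \<Rightarrow> bool" where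
  "knot_diagram D \<longleftrightarrow>
     smooth_map (curve D) \<and>
     (\<forall>t. curve D (t + 1) = curve D t) \<and>
     (\<forall>t. tangent D t \<noteq> 0) \<and>
     finite (crossings D) \<and>
     (\<forall>r s t. \<not> (double_pair D r s \<and> double_pair D s t \<and> double_pair D r t)) \<and>
     (\<forall>s t. double_pair D s t \<longrightarrow> cross2 (tangent D s) (tangent D t) \<noteq> 0) \<and>
     over D \<subseteq> {t. curve D t \<in> crossings D} \<and>
     (\<forall>t. t + 1 \<in> over D \<longleftrightarrow> t \<in> over D) \<and>
     (\<forall>s t. double_pair D s t \<longrightarrow> (s \<in> over D \<longleftrightarrow> t \<notin> over D))"

definition change_crossings :: "complex set \<Rightarrow> diagram \<Rightarrow> diagram" where
  "change_crossings X D = D\<lparr>over := {t. t \<in> over D \<longleftrightarrow> curve D t \<notin> X}\<rparr>"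


section \<open>The Self-Crossing Index\<close>

definition over_dir :: "diagram \<Rightarrow> complex \<Rightarrow> complex" where
  "over_dir D c = tangent D (THE t. t \<in> {0..<1} \<and> curve D t = c \<and> t \<in> over D)"

definition under_dir :: "diagram \<Rightarrow> complex \<Rightarrow> complex" where
  "under_dir D c = tangent D (THE t. t \<in> {0..<1} \<and> curve D t = c \<and> t \<notin> over D)"

text \<open>A crossing is positive iff the over strand direction is turned counterclockwise (by less
  than a half turn) onto the under strand direction.\<close>

definition crossing_sign :: "diagram \<Rightarrow> complex \<Rightarrow> real" where
  "crossing_sign D c = sgn (cross2 (over_dir D c) (under_dir D c))"

definition regions :: "diagram \<Rightarrow> complex set set" where
  "regions D = components (- image_curve D)"

definition region_index :: "diagram \<Rightarrow> complex set \<Rightarrow> int" where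
  "region_index D R = (THE k. \<forall>p\<in>R. winding_number (curve D) p = of_int k)"

text \<open>The four corners at a crossing are the sectors between the directions \<open>\<sigma> * over_dir\<close> and
  \<open>\<tau> * under_dir\<close> for signs \<open>\<sigma>\<close>, \<open>\<tau>\<close>; each of them lies, near the crossing, in one region.\<close>

definition corner_region :: "diagram \<Rightarrow> complex \<Rightarrow> real \<Rightarrow> real \<Rightarrow> complex set" where
  "corner_region D c \<sigma> \<tau> =
     (THE R. R \<in> regions D \<and>
        (\<forall>\<^sub>F \<epsilon> in at_right 0. c + \<epsilon> *\<^sub>R (\<sigma> *\<^sub>R over_dir D c + \<tau> *\<^sub>R under_dir D c) \<in> R))"

text \<open>The average runs over the four corners, so a region is counted with multiplicity.\<close>

definition crossing_index :: "diagram \<Rightarrow> complex \<Rightarrow> real" where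
  "crossing_index D c =
     (\<Sum>\<sigma>\<in>{1, -1}. \<Sum>\<tau>\<in>{1, -1}. real_of_int (region_index D (corner_region D c \<sigma> \<tau>))) / 4"

definition SCI :: "diagram \<Rightarrow> real" where
  "SCI D = (\<Sum>c\<in>crossings D. crossing_sign D c * crossing_index D c)"


section \<open>Diagram invariants\<close>

text \<open>An isotopy of the plane through diffeomorphisms, starting at the identity, is required to
  be only jointly \<open>C\<^sup>1\<close> in the sense that the maps and their differentials depend continuously
  on time and position.  Every smooth isotopy is of this form.\<close>

definition plane_isotopy :: "(real \<Rightarrow> complex \<Rightarrow> complex) \<Rightarrow> bool" where
  "plane_isotopy H \<longleftrightarrow>
     (\<forall>z. H 0 z = z) \<and>
     (\<forall>s\<in>{0..1}. bij (H s)) \<and>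
     continuous_on ({0..1} \<times> UNIV) (\<lambda>(s, z). H s z) \<and>
     (\<exists>H' :: real \<Rightarrow> complex \<Rightarrow> complex \<Rightarrow>\<^sub>L complex.
        (\<forall>s\<in>{0..1}. \<forall>z. (H s has_derivative blinfun_apply (H' s z)) (at z) \<and>
           bij (blinfun_apply (H' s z))) \<and>
        continuous_on ({0..1} \<times> UNIV) (\<lambda>(s, z). H' s z))"

definition circle_reparametrization :: "(real \<Rightarrow> real) \<Rightarrow> bool" where
  "circle_reparametrization \<phi> \<longleftrightarrow>
     smooth_map \<phi> \<and> (\<forall>t. \<phi> (t + 1) = \<phi> t + 1) \<and> (\<forall>t. vector_derivative \<phi> (at t) > 0)"

text \<open>Equality of oriented diagrams up to planar isotopy and choice of parametrization.\<close>

definition same_diagram :: "diagram \<Rightarrow> diagram \<Rightarrow> bool" where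
  "same_diagram D E \<longleftrightarrow>
     (\<exists>H \<phi>. plane_isotopy H \<and> circle_reparametrization \<phi> \<and>
        curve E = H 1 \<circ> curve D \<circ> \<phi> \<and> over E = \<phi> -` over D)"

definition diagram_invariant :: "(diagram \<Rightarrow> 'a) \<Rightarrow> bool" where
  "diagram_invariant I \<longleftrightarrow>
     (\<forall>D E. knot_diagram D \<longrightarrow> knot_diagram E \<longrightarrow> same_diagram D E \<longrightarrow> I D = I E)"

definition alternating_sum ::
    "(diagram \<Rightarrow> 'a::ab_group_add) \<Rightarrow> diagram \<Rightarrow> complex set \<Rightarrow> 'a" where
  "alternating_sum I D S =
     (\<Sum>X\<in>Pow S. if even (card X) then I (change_crossings X D)
                 else - I (change_crossings X D))"

definition vassiliev_order_at_most :: "(diagram \<Rightarrow> 'a::ab_group_add) \<Rightarrow> nat \<Rightarrow> bool" where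
  "vassiliev_order_at_most I m \<longleftrightarrow>
     (\<forall>D S. knot_diagram D \<longrightarrow> S \<subseteq> crossings D \<longrightarrow> card S = m + 1 \<longrightarrow>
        alternating_sum I D S = 0)"

definition vassiliev_order :: "(diagram \<Rightarrow> 'a::ab_group_add) \<Rightarrow> nat \<Rightarrow> bool" where
  "vassiliev_order I m \<longleftrightarrow>
     vassiliev_order_at_most I m \<and>
     (\<exists>D S. knot_diagram D \<and> S \<subseteq> crossings D \<and> card S = m \<and> alternating_sum I D S \<noteq> 0)"

end

theory Submission
  imports Defs
begin

text \<open>
  Changing a crossing exchanges its over and under strand.  This reverses the sign of the crossing
  but leaves its index unchanged, because the index averages over all four corners and sees the
  underlying curve only.  Hence \<^const>\<open>SCI\<close> is a sum of terms that each change sign with a single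
  crossing: alternating sums over two crossings vanish (\<open>SCI_order_at_most_1\<close>), and the
  alternating sum over one crossing \<open>c\<close> is twice the term of \<open>c\<close>
  (\<open>alternating_sum_SCI_singleton\<close>).  A diagram with a crossing of non-zero index therefore shows
  that the order is exactly 1.  The figure-eight curve would not do, since its crossing has index
  0; the limacon, the image of the unit circle under \<open>z\<^sup>2 + z\<close>, has positive index at its only
  crossing, because its winding numbers count roots of a polynomial in the unit disc and are
  therefore non-negative everywhere and positive on one of the corners.

  Invariance has a global and a local part.  Globally, an isotopy of the plane transports winding
  numbers when the observed point moves along (\<open>winding_number_isotopy\<close>).  Locally, the index of a
  corner has to be read off from winding numbers near the crossing: close to a transverse double
  point the curve stays close to its two tangent lines (\<open>crossing_sector_avoids_curve\<close>), so the
  winding number seen in a direction between the strands is well defined and the same for all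
  directions in one corner (\<open>germ_index_sector\<close>).  The derivative of the isotopy maps corners to
  corners, and it preserves signs of crossings because its determinant stays positive along the
  isotopy.
\<close>

section \<open>Crossing changes\<close>

lemma crossings_change [simp]: "crossings (change_crossings X D) = crossings D"
  by (simp add: crossings_def double_pair_def change_crossings_def)

text \<open>
  At a changed crossing, the predicates inside the definite descriptions of the two directions
  become each other, because exactly the parameters of that crossing switch between over and under.
\<close>

lemma over_dir_change:
  "over_dir (change_crossings X D) c = (if c \<in> X then under_dir D c else over_dir D c)"
proof (cases "c \<in> X")
  case True
  have "(\<lambda>t. t \<in> {0..<1} \<and> curve D t = c \<and> (t \<in> over D \<longleftrightarrow> curve D t \<notin> X)) =
        (\<lambda>t. t \<in> {0..<1} \<and> curve D t = c \<and> t \<notin> over D)"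
    using True by auto
  with True show ?thesis
    by (simp add: over_dir_def under_dir_def change_crossings_def tangent_def)
next
  case False
  have "(\<lambda>t. t \<in> {0..<1} \<and> curve D t = c \<and> (t \<in> over D \<longleftrightarrow> curve D t \<notin> X)) =
        (\<lambda>t. t \<in> {0..<1} \<and> curve D t = c \<and> t \<in> over D)"
    using False by auto
  with False show ?thesis
    by (simp add: over_dir_def change_crossings_def tangent_def)
qed

lemma under_dir_change:
  "under_dir (change_crossings X D) c = (if c \<in> X then over_dir D c else under_dir D c)"
proof (cases "c \<in> X")
  case True
  have "(\<lambda>t. t \<in> {0..<1} \<and> curve D t = c \<and> (t \<in> over D \<longleftrightarrow> curve D t \<in> X)) =
        (\<lambda>t. t \<in> {0..<1} \<and> curve D t = c \<and> t \<in> over D)"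
    using True by auto
  with True show ?thesis
    by (simp add: over_dir_def under_dir_def change_crossings_def tangent_def)
next
  case False
  have "(\<lambda>t. t \<in> {0..<1} \<and> curve D t = c \<and> (t \<in> over D \<longleftrightarrow> curve D t \<in> X)) =
        (\<lambda>t. t \<in> {0..<1} \<and> curve D t = c \<and> t \<notin> over D)"
    using False by auto
  with False show ?thesis
    by (simp add: under_dir_def change_crossings_def tangent_def)
qed

lemma crossing_sign_change:
  "crossing_sign (change_crossings X D) c = (if c \<in> X then - 1 else 1) * crossing_sign D c"
proof -
  have "cross2 (under_dir D c) (over_dir D c) = - cross2 (over_dir D c) (under_dir D c)"
    by (simp add: cross2_def)
  then show ?thesis
    by (simp add: crossing_sign_def over_dir_change under_dir_change sgn_minus)
qed

lemma region_index_change [simp]: "region_index (change_crossings X D) R = region_index D R"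
  by (simp add: region_index_def change_crossings_def)

lemma corner_region_change:
  "corner_region (change_crossings X D) c \<sigma> \<tau> =
     (if c \<in> X then corner_region D c \<tau> \<sigma> else corner_region D c \<sigma> \<tau>)"
proof -
  have "regions (change_crossings X D) = regions D"
    by (simp add: regions_def image_curve_def change_crossings_def)
  then show ?thesis
    by (simp add: corner_region_def over_dir_change under_dir_change add.commute)
qed

text \<open>
  The sum over the four corners is symmetric under exchanging the two strands.
\<close>

lemma crossing_index_change: "crossing_index (change_crossings X D) c = crossing_index D c"
proof (cases "c \<in> X")
  case True
  then show ?thesis
    unfolding crossing_index_def by (simp add: corner_region_change)
next
  case False
  then show ?thesis
    by (simp add: crossing_index_def corner_region_change)
qed

lemma SCI_change:
  "SCI (change_crossings X D) =
     (\<Sum>c\<in>crossings D. (if c \<in> X then - 1 else 1) * (crossing_sign D c * crossing_index D c))"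
  by (simp add: SCI_def crossing_sign_change crossing_index_change mult.assoc)

text \<open>
  Each summand of \<^const>\<open>SCI\<close> sees only the change of its own crossing.  If two distinct crossings are
  changed, then every summand is unaffected by at least one of the two changes, so its
  contributions to the alternating sum cancel in pairs.
\<close>

lemma SCI_order_at_most_1: "vassiliev_order_at_most SCI 1"
  unfolding vassiliev_order_at_most_def
proof (intro allI impI)
  fix D S
  assume "knot_diagram D" and "S \<subseteq> crossings D" and "card S = 1 + 1"
  then obtain a b where S: "S = {a, b}" and "a \<noteq> b"
    by (metis card_2_iff one_add_one)
  have Pow: "Pow S = {{}, {a}, {b}, {a, b}}"
    unfolding S by auto
  have "alternating_sum SCI D S =
    SCI (change_crossings {} D) - SCI (change_crossings {a} D)
    - SCI (change_crossings {b} D) + SCI (change_crossings {a, b} D)"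
    using \<open>a \<noteq> b\<close> by (simp add: alternating_sum_def Pow doubleton_eq_iff insert_commute)
  also have "\<dots> = 0"
    unfolding SCI_change sum_subtractf [symmetric] sum.distrib [symmetric]
    using \<open>a \<noteq> b\<close> by (intro sum.neutral) auto
  finally show "alternating_sum SCI D S = 0" .
qed

lemma alternating_sum_SCI_singleton:
  assumes "finite (crossings D)" and "c \<in> crossings D"
  shows "alternating_sum SCI D {c} = 2 * (crossing_sign D c * crossing_index D c)"
proof -
  have "alternating_sum SCI D {c} = SCI (change_crossings {} D) - SCI (change_crossings {c} D)"
    by (simp add: alternating_sum_def Pow_insert)
  also have "\<dots> = (\<Sum>d\<in>crossings D. if d = c then 2 * (crossing_sign D d * crossing_index D d) else 0)"
    unfolding SCI_change sum_subtractf [symmetric]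
    by (intro sum.cong) auto
  finally show ?thesis
    using assms by simp
qed

section \<open>Parameters of a crossing\<close>

lemma smooth_map_has_vector_derivative:
  assumes "smooth_map f"
  shows "(f has_vector_derivative vector_derivative f (at t)) (at t)"
  using assms unfolding smooth_map_def by (metis vector_derivative_at)

text \<open>
  The value type is arbitrary so that the lemma covers the curve, the truth value of being an over
  parameter, and the displacement of a circle reparametrization.
\<close>

lemma periodic_int:
  fixes f :: "real \<Rightarrow> 'a"
  assumes "\<And>t. f (t + 1) = f t"
  shows "f (t + of_int n) = f t"
proof (induction n rule: int_induct [where k = 0])
  case (step1 i)
  then show ?case using assms [of "t + of_int i"] by (simp add: add.assoc)
next
  case (step2 i)
  then show ?case using assms [of "t + of_int (i - 1)"] by (simp add: algebra_simps)
qed simp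

context
  fixes D
  assumes D: "knot_diagram D"
begin

lemma curve_has_vector_derivative: "(curve D has_vector_derivative tangent D t) (at t)"
  using D smooth_map_has_vector_derivative unfolding knot_diagram_def tangent_def by blast

lemma continuous_on_curve: "continuous_on T (curve D)"
  using curve_has_vector_derivative continuous_at_imp_continuous_on has_vector_derivative_continuous
  by blast

lemma path_curve: "path (curve D)"
  by (simp add: path_def continuous_on_curve)

lemma curve_add_int: "curve D (t + of_int n) = curve D t"
  using D by (intro periodic_int) (simp add: knot_diagram_def)

lemma curve_cong_int: "s - t \<in> \<int> \<Longrightarrow> curve D s = curve D t"
  by (metis Ints_cases curve_add_int diff_add_cancel add.commute)

lemma over_cong_int: "s - t \<in> \<int> \<Longrightarrow> s \<in> over D \<longleftrightarrow> t \<in> over D"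
proof -
  assume "s - t \<in> \<int>"
  then obtain n where "s = t + of_int n"
    by (metis Ints_cases diff_add_cancel add.commute)
  then show ?thesis
    using D periodic_int [of "\<lambda>t. t \<in> over D" t n] by (simp add: knot_diagram_def)
qed

lemma tangent_cong_int:
  assumes "s - t \<in> \<int>"
  shows "tangent D s = tangent D t"
proof -
  have "((\<lambda>x. curve D (x + (s - t))) has_vector_derivative tangent D s) (at t)"
    using vector_diff_chain_at [of "\<lambda>x. x + (s - t)" 1 t "curve D" "tangent D s"]
      curve_has_vector_derivative [of s]
    by (simp add: o_def has_vector_derivative_add_const)
  moreover have "curve D (x + (s - t)) = curve D x" for x
    using assms by (intro curve_cong_int) simp
  ultimately show ?thesis
    using curve_has_vector_derivative [of t] vector_derivative_unique_at by fastforce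
qed

lemma path_image_curve: "path_image (curve D) = range (curve D)"
proof -
  have "curve D t \<in> curve D ` {0..1}" for t
  proof
    show "curve D t = curve D (frac t)"
      by (intro curve_cong_int) (simp add: frac_def)
    show "frac t \<in> {0..1}"
      using frac_lt_1 [of t] by simp
  qed
  then show ?thesis
    by (auto simp: path_image_def)
qed

lemma loop_curve: "pathfinish (curve D) = pathstart (curve D)"
  using D by (metis knot_diagram_def add.left_neutral pathfinish_def pathstart_def)

lemma crossing_parameters:
  assumes "c \<in> crossings D"
  obtains s t where "double_pair D s t" "curve D s = c" "curve D t = c" "s \<in> over D" "t \<notin> over D"
proof -
  obtain s t where st: "double_pair D s t" "curve D s = c"
    using assms by (auto simp: crossings_def)
  then have "double_pair D t s" "curve D t = c"
    by (auto simp: double_pair_def) (metis Ints_minus minus_diff_eq)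
  then show thesis
    using that st D unfolding knot_diagram_def by metis
qed

text \<open>
  Double points are never triple and each has exactly one over strand, so up to an integer a
  parameter is determined by its image together with its over/under status.  Hence the parameter
  selected by \<^const>\<open>over_dir\<close> or \<^const>\<open>under_dir\<close> may be replaced by any parameter of that strand,
  without reduction to the interval from 0 to 1.
\<close>

lemma strand_parameter:
  "(THE t. t \<in> {0..<1} \<and> curve D t = curve D s \<and> (t \<in> over D \<longleftrightarrow> s \<in> over D)) = frac s"
proof (rule the_equality)
  have "frac s - s \<in> \<int>"
    by (simp add: frac_def)
  then show "frac s \<in> {0..<1} \<and> curve D (frac s) = curve D s \<and> (frac s \<in> over D \<longleftrightarrow> s \<in> over D)"
    using over_cong_int curve_cong_int by (simp add: frac_lt_1)
next
  fix t assume t: "t \<in> {0..<1} \<and> curve D t = curve D s \<and> (t \<in> over D \<longleftrightarrow> s \<in> over D)"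
  then have "\<not> double_pair D t s"
    using D unfolding knot_diagram_def by blast
  then have "t - s \<in> \<int>"
    using t by (simp add: double_pair_def)
  then show "t = frac s"
    using t Ints_minus [of "t - s"] frac_unique_iff [of s t] by simp
qed

lemma tangent_frac: "tangent D (frac s) = tangent D s"
  by (rule tangent_cong_int) (simp add: frac_def)

lemma over_dir_eq_tangent: "s \<in> over D \<Longrightarrow> over_dir D (curve D s) = tangent D s"
  using strand_parameter [of s] by (simp add: over_dir_def tangent_frac)

lemma under_dir_eq_tangent: "s \<notin> over D \<Longrightarrow> under_dir D (curve D s) = tangent D s"
  using strand_parameter [of s] by (simp add: under_dir_def tangent_frac)

end

section \<open>Winding numbers near a crossing\<close>

lemma abs_cross2_le: "\<bar>cross2 u v\<bar> \<le> norm u * norm v"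
proof -
  have "cross2 u v = Im (cnj u * v)"
    by (simp add: cross2_def)
  then show ?thesis
    using abs_Im_le_cmod [of "cnj u * v"] by (simp add: norm_mult)
qed

lemma tendsto_cross2 [tendsto_intros]:
  "(f \<longlongrightarrow> a) F \<Longrightarrow> (g \<longlongrightarrow> b) F \<Longrightarrow> ((\<lambda>x. cross2 (f x) (g x)) \<longlongrightarrow> cross2 a b) F"
  unfolding cross2_def by (intro tendsto_intros)

lemma cross2_algebra:
  "cross2 (a *\<^sub>R u) v = a * cross2 u v" "cross2 u (a *\<^sub>R v) = a * cross2 u v"
  "cross2 u (v + v') = cross2 u v + cross2 u v'"
  "cross2 (u - u') v = cross2 u v - cross2 u' v"
  "cross2 u u = 0"
  by (simp_all add: cross2_def algebra_simps)

text \<open>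
  The winding number \<open>k\<close> observed close to \<open>c\<close> in direction \<open>v\<close>.  Directions near \<open>v\<close> are included
  because a diffeomorphism maps a straight segment leaving \<open>c\<close> to an arc that is only tangent to
  such a segment.
\<close>

definition germ_index :: "diagram \<Rightarrow> complex \<Rightarrow> complex \<Rightarrow> int \<Rightarrow> bool" where
  "germ_index D c v k \<longleftrightarrow>
     (\<exists>\<delta>>0. \<forall>\<epsilon> w. 0 < \<epsilon> \<longrightarrow> \<epsilon> < \<delta> \<longrightarrow> dist w v < \<delta> \<longrightarrow>
        c + \<epsilon> *\<^sub>R w \<notin> path_image (curve D) \<and>
        winding_number (curve D) (c + \<epsilon> *\<^sub>R w) = of_int k)"

lemma germ_index_unique:
  assumes "germ_index D c v k" "germ_index D c v l"
  shows "k = l"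
proof -
  obtain \<delta> \<delta>' where "\<delta> > 0" "\<delta>' > 0"
    and "\<And>\<epsilon>. 0 < \<epsilon> \<Longrightarrow> \<epsilon> < \<delta> \<Longrightarrow> winding_number (curve D) (c + \<epsilon> *\<^sub>R v) = of_int k"
    and "\<And>\<epsilon>. 0 < \<epsilon> \<Longrightarrow> \<epsilon> < \<delta>' \<Longrightarrow> winding_number (curve D) (c + \<epsilon> *\<^sub>R v) = of_int l"
    using assms unfolding germ_index_def by (metis dist_self)
  then have "(of_int k :: complex) = of_int l"
    by (metis field_lbound_gt_zero)
  then show ?thesis
    by simp
qed

text \<open>
  A constant \<open>w\<close> describes the approach to \<open>c\<close> along a straight segment; a convergent \<open>w\<close> describes
  the approach along the image of such a segment under a differentiable map.
\<close>

lemma germ_index_eventually: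
  assumes "germ_index D c v k" and "(w \<longlongrightarrow> v) (at_right 0)"
  shows "\<forall>\<^sub>F \<epsilon> in at_right 0. c + \<epsilon> *\<^sub>R w \<epsilon> \<notin> path_image (curve D) \<and>
           winding_number (curve D) (c + \<epsilon> *\<^sub>R w \<epsilon>) = of_int k"
proof -
  obtain \<delta> where "\<delta> > 0" and \<delta>: "\<And>\<epsilon> w. 0 < \<epsilon> \<Longrightarrow> \<epsilon> < \<delta> \<Longrightarrow> dist w v < \<delta> \<Longrightarrow>
        c + \<epsilon> *\<^sub>R w \<notin> path_image (curve D) \<and>
        winding_number (curve D) (c + \<epsilon> *\<^sub>R w) = of_int k"
    using assms(1) unfolding germ_index_def by metis
  have "\<forall>\<^sub>F \<epsilon> in at_right (0::real). 0 < \<epsilon> \<and> \<epsilon> < \<delta>"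
    using \<open>\<delta> > 0\<close> eventually_at_right_field by blast
  moreover have "\<forall>\<^sub>F \<epsilon> in at_right 0. dist (w \<epsilon>) v < \<delta>"
    using assms(2) \<open>\<delta> > 0\<close> by (rule tendstoD)
  ultimately show ?thesis
    by eventually_elim (use \<delta> in blast)
qed

context
  fixes D
  assumes D: "knot_diagram D"
begin

lemma region_index_winding_number:
  assumes "R \<in> regions D" "p \<in> R"
  shows "winding_number (curve D) p = of_int (region_index D R)"
proof -
  have R: "connected R" "R \<inter> path_image (curve D) = {}"
    using assms in_components_connected in_components_subset
    by (fastforce simp: regions_def image_curve_def)+
  then have "winding_number (curve D) constant_on R"
    using winding_number_constant path_curve loop_curve D by blast
  moreover have "winding_number (curve D) p \<in> \<int>"
    using integer_winding_number path_curve loop_curve D R assms by blast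
  ultimately obtain k where k: "\<forall>q\<in>R. winding_number (curve D) q = of_int k"
    by (metis Ints_cases assms(2) constant_on_def)
  then have "region_index D R = k"
    unfolding region_index_def
  proof (rule the_equality)
    fix l assume "\<forall>q\<in>R. winding_number (curve D) q = of_int l"
    then show "l = k"
      using k assms(2) by (metis of_int_eq_iff)
  qed
  then show ?thesis
    using k assms(2) by blast
qed

text \<open>
  Along a sequence of points of the curve that converges to a double point, the parameters
  accumulate at a parameter of the double point, so the directions in which the points are seen
  accumulate, up to sign and length, at one of the two tangents.  A direction that is parallel to neither tangent therefore has
  a neighbourhood in which the curve is not seen close to the crossing.
\<close>

lemma crossing_sector_avoids_curve:
  assumes c: "c \<in> crossings D"
    and o: "cross2 (over_dir D c) v \<noteq> 0" and u: "cross2 (under_dir D c) v \<noteq> 0"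
  shows "\<exists>\<delta>>0. \<forall>\<epsilon> w. 0 < \<epsilon> \<longrightarrow> \<epsilon> < \<delta> \<longrightarrow> dist w v < \<delta> \<longrightarrow> c + \<epsilon> *\<^sub>R w \<notin> path_image (curve D)"
proof (rule ccontr)
  assume contra: "\<not> ?thesis"
  have "\<exists>\<epsilon> w \<tau>. 0 < \<epsilon> \<and> \<epsilon> < 1 / Suc n \<and> dist w v < 1 / Suc n \<and> \<tau> \<in> {0..1} \<and>
          curve D \<tau> = c + \<epsilon> *\<^sub>R w" for n
  proof -
    obtain \<epsilon> w where "0 < \<epsilon>" "\<epsilon> < 1 / Suc n" "dist w v < 1 / Suc n"
        "c + \<epsilon> *\<^sub>R w \<in> path_image (curve D)"
      using contra by (metis of_nat_0_less_iff zero_less_Suc zero_less_divide_1_iff)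
    then show ?thesis
      unfolding path_image_def image_iff by metis
  qed
  then obtain \<epsilon> w \<tau> where "\<And>n. 0 < \<epsilon> n" and \<epsilon>: "\<And>n. \<epsilon> n < 1 / Suc n"
    and w: "\<And>n. dist (w n) v < 1 / Suc n" and \<tau>: "\<And>n. \<tau> n \<in> {0..1}"
    and eq: "\<And>n. curve D (\<tau> n) = c + \<epsilon> n *\<^sub>R w n"
    by metis
  have lim_\<epsilon>: "\<epsilon> \<longlonglongrightarrow> 0"
  proof (rule Lim_null_comparison [OF always_eventually LIMSEQ_inverse_real_of_nat], rule allI)
    show "norm (\<epsilon> n) \<le> inverse (real (Suc n))" for n
      using \<open>0 < \<epsilon> n\<close> \<epsilon> [of n] by (simp add: inverse_eq_divide)
  qed
  have "(\<lambda>n. dist (w n) v) \<longlonglongrightarrow> 0"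
  proof (rule Lim_null_comparison [OF always_eventually LIMSEQ_inverse_real_of_nat], rule allI)
    show "norm (dist (w n) v) \<le> inverse (real (Suc n))" for n
      using w [of n] by (simp add: inverse_eq_divide)
  qed
  then have lim_w: "w \<longlonglongrightarrow> v"
    by (rule tendsto_dist_iff [THEN iffD2])
  obtain l r where r: "strict_mono r" and l: "(\<tau> \<circ> r) \<longlonglongrightarrow> l"
    using seq_compactE [OF compact_imp_seq_compact [OF compact_Icc [of "0::real" 1]], of \<tau>] \<tau>
    by metis
  have "(\<lambda>n. curve D ((\<tau> \<circ> r) n)) \<longlonglongrightarrow> curve D l"
    by (rule continuous_on_tendsto_compose [OF continuous_on_curve [OF D, of UNIV] l]) auto
  moreover have "((\<lambda>n. c + \<epsilon> n *\<^sub>R w n) \<circ> r) \<longlonglongrightarrow> c + 0 *\<^sub>R v"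
    by (rule LIMSEQ_subseq_LIMSEQ [OF tendsto_add [OF tendsto_const tendsto_scaleR [OF lim_\<epsilon> lim_w]] r])
  ultimately have "curve D l = c + 0 *\<^sub>R v"
    unfolding o_def eq by (rule LIMSEQ_unique)
  then have l_c: "curve D l = c"
    by simp
  define T where "T = tangent D l"
  have T: "cross2 T v \<noteq> 0"
    using o u c l_c over_dir_eq_tangent [OF D, of l] under_dir_eq_tangent [OF D, of l]
    by (cases "l \<in> over D") (auto simp: T_def)
  then have "v \<noteq> 0"
    by (auto simp: cross2_def)
  \<comment> \<open>Small enough to contradict the bound \<open>\<bar>cross2 T v\<bar> \<le> e * norm v\<close> obtained in the limit.\<close>
  define e where "e = \<bar>cross2 T v\<bar> / (2 * norm v)"
  have "e > 0"
    using T \<open>v \<noteq> 0\<close> by (simp add: e_def)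
  have "(curve D has_derivative (\<lambda>h. h *\<^sub>R T)) (at l)"
    using curve_has_vector_derivative [OF D] by (simp add: T_def has_vector_derivative_def)
  then obtain d where "d > 0"
    and d: "\<And>y. \<bar>y - l\<bar> < d \<Longrightarrow> norm (curve D y - curve D l - (y - l) *\<^sub>R T) \<le> e * \<bar>y - l\<bar>"
    using \<open>e > 0\<close> unfolding has_derivative_at_alt real_norm_def by metis
  have "\<forall>\<^sub>F n in sequentially. dist ((\<tau> \<circ> r) n) l < d"
    using tendstoD [OF l \<open>d > 0\<close>] .
  moreover have lim_wr: "(w \<circ> r) \<longlonglongrightarrow> v"
    by (rule LIMSEQ_subseq_LIMSEQ [OF lim_w r])
  then have "\<forall>\<^sub>F n in sequentially. (w \<circ> r) n \<noteq> 0"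
    using \<open>v \<noteq> 0\<close> by (rule tendsto_imp_eventually_ne)
  ultimately have "\<forall>\<^sub>F n in sequentially. \<bar>cross2 T ((w \<circ> r) n)\<bar> \<le> e * norm ((w \<circ> r) n)"
  proof eventually_elim
    case (elim n)
    define t where "t = \<tau> (r n)"
    define x where "x = w (r n)"
    have t: "curve D t - curve D l = \<epsilon> (r n) *\<^sub>R x"
      by (simp add: t_def x_def eq l_c)
    have "t \<noteq> l"
      using t elim \<open>\<And>n. 0 < \<epsilon> n\<close> by (auto simp: x_def) (metis less_irrefl)
    \<comment> \<open>The displacement along the curve is parallel to \<open>x\<close>, so only the linearization error contributes.\<close>
    have "\<bar>t - l\<bar> * \<bar>cross2 T x\<bar> = \<bar>cross2 (curve D t - curve D l - (t - l) *\<^sub>R T) x\<bar>"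
      unfolding t by (simp add: cross2_algebra abs_mult)
    also have "\<dots> \<le> norm (curve D t - curve D l - (t - l) *\<^sub>R T) * norm x"
      by (rule abs_cross2_le)
    also have "\<dots> \<le> e * \<bar>t - l\<bar> * norm x"
      using d [of t] elim by (intro mult_right_mono) (auto simp: t_def dist_real_def)
    finally show ?case
      using \<open>t \<noteq> l\<close> by (simp add: x_def mult.commute mult.left_commute)
  qed
  moreover have "(\<lambda>n. \<bar>cross2 T ((w \<circ> r) n)\<bar>) \<longlonglongrightarrow> \<bar>cross2 T v\<bar>"
    by (intro tendsto_intros lim_wr)
  moreover have "(\<lambda>n. e * norm ((w \<circ> r) n)) \<longlonglongrightarrow> e * norm v"
    by (intro tendsto_intros lim_wr)
  ultimately have "\<bar>cross2 T v\<bar> \<le> e * norm v"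
    by (intro tendsto_le [of sequentially]) auto
  then show False
    using T \<open>v \<noteq> 0\<close> by (simp add: e_def)
qed

lemma germ_index_exists:
  assumes "c \<in> crossings D"
    and "cross2 (over_dir D c) v \<noteq> 0" and "cross2 (under_dir D c) v \<noteq> 0"
  shows "\<exists>k. germ_index D c v k"
proof -
  obtain \<delta> where "\<delta> > 0"
    and \<delta>: "\<And>\<epsilon> w. 0 < \<epsilon> \<Longrightarrow> \<epsilon> < \<delta> \<Longrightarrow> dist w v < \<delta> \<Longrightarrow> c + \<epsilon> *\<^sub>R w \<notin> path_image (curve D)"
    using crossing_sector_avoids_curve [OF assms] by metis
  define S where "S = (\<lambda>(\<epsilon>, w). c + \<epsilon> *\<^sub>R w) ` ({0<..<\<delta>} \<times> ball v \<delta>)"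
  have "connected S"
    unfolding S_def case_prod_beta
    by (intro connected_continuous_image convex_connected convex_Times continuous_intros) auto
  moreover have S: "S \<inter> path_image (curve D) = {}"
    using \<delta> by (auto simp: S_def dist_commute)
  ultimately have "winding_number (curve D) constant_on S"
    using winding_number_constant path_curve [OF D] loop_curve [OF D] by blast
  moreover have p: "c + (\<delta> / 2) *\<^sub>R v \<in> S"
    using \<open>\<delta> > 0\<close> by (force simp: S_def)
  moreover have "winding_number (curve D) (c + (\<delta> / 2) *\<^sub>R v) \<in> \<int>"
    using integer_winding_number path_curve [OF D] loop_curve [OF D] p S by blast
  ultimately obtain k where k: "\<forall>q\<in>S. winding_number (curve D) q = of_int k"
    by (metis Ints_cases constant_on_def)
  have "c + \<epsilon> *\<^sub>R w \<in> S" if "0 < \<epsilon>" "\<epsilon> < \<delta>" "dist w v < \<delta>" for \<epsilon> w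
    using that by (force simp: S_def dist_commute)
  then show ?thesis
    unfolding germ_index_def using k \<delta> \<open>\<delta> > 0\<close> by metis
qed

lemma cross2_over_under: 
  assumes "c \<in> crossings D"
  shows "cross2 (over_dir D c) (under_dir D c) \<noteq> 0"
proof -
  obtain s t where "double_pair D s t" "curve D s = c" "curve D t = c" "s \<in> over D" "t \<notin> over D"
    using crossing_parameters [OF D assms] by metis
  then show ?thesis
    using D assms over_dir_eq_tangent [OF D, of s] under_dir_eq_tangent [OF D, of t]
    unfolding knot_diagram_def by metis
qed

lemma sector_direction:
  assumes "c \<in> crossings D" "a \<noteq> 0" "b \<noteq> 0"
    and "v = a *\<^sub>R over_dir D c + b *\<^sub>R under_dir D c"
  shows "cross2 (over_dir D c) v \<noteq> 0" and "cross2 (under_dir D c) v \<noteq> 0"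
proof -
  have "cross2 (under_dir D c) (over_dir D c) = - cross2 (over_dir D c) (under_dir D c)"
    by (simp add: cross2_def)
  then show "cross2 (over_dir D c) v \<noteq> 0" "cross2 (under_dir D c) v \<noteq> 0"
    using assms cross2_over_under by (simp_all add: cross2_algebra)
qed

text \<open>
  This makes the two definite descriptions in the definition of the crossing index meaningful: the
  segment leaving the crossing into a corner is connected and off the curve, so it lies in one
  region, and the index of that region is the winding number seen along the segment.
\<close>

lemma germ_index_corner_region:
  assumes c: "c \<in> crossings D" and "\<sigma> \<noteq> 0" "\<tau> \<noteq> 0"
  shows "germ_index D c (\<sigma> *\<^sub>R over_dir D c + \<tau> *\<^sub>R under_dir D c)
           (region_index D (corner_region D c \<sigma> \<tau>))"
proof -
  define v where "v = \<sigma> *\<^sub>R over_dir D c + \<tau> *\<^sub>R under_dir D c"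
  obtain k where k: "germ_index D c v k"
    using germ_index_exists sector_direction assms v_def by metis
  then obtain \<delta> where "\<delta> > 0" and \<delta>: "\<And>\<epsilon>. 0 < \<epsilon> \<Longrightarrow> \<epsilon> < \<delta> \<Longrightarrow>
        c + \<epsilon> *\<^sub>R v \<notin> path_image (curve D) \<and> winding_number (curve D) (c + \<epsilon> *\<^sub>R v) = of_int k"
    unfolding germ_index_def by (metis dist_self)
  define S where "S = (\<lambda>\<epsilon>. c + \<epsilon> *\<^sub>R v) ` {0<..<\<delta>}"
  define p where "p = c + (\<delta> / 2) *\<^sub>R v"
  define R where "R = connected_component_set (- path_image (curve D)) p"
  have "p \<in> S"
    using \<open>\<delta> > 0\<close> by (auto simp: S_def p_def)
  have "connected S"
    unfolding S_def by (intro connected_continuous_image continuous_intros) auto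
  moreover have "S \<subseteq> - path_image (curve D)"
    using \<delta> by (auto simp: S_def)
  ultimately have "S \<subseteq> R"
    using \<open>p \<in> S\<close> unfolding R_def by (intro connected_component_maximal)
  have R: "R \<in> regions D"
    using \<open>p \<in> S\<close> \<open>S \<subseteq> - path_image (curve D)\<close>
    by (auto simp: R_def regions_def image_curve_def components_def)
  have small: "\<forall>\<^sub>F \<epsilon> in at_right (0::real). 0 < \<epsilon> \<and> \<epsilon> < \<delta>"
    using \<open>\<delta> > 0\<close> eventually_at_right_field by blast
  then have ev: "\<forall>\<^sub>F \<epsilon> in at_right 0. c + \<epsilon> *\<^sub>R v \<in> R"
  proof (rule eventually_mono)
    fix \<epsilon> assume "0 < \<epsilon> \<and> \<epsilon> < \<delta>"
    then have "c + \<epsilon> *\<^sub>R v \<in> S"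
      unfolding S_def by (intro imageI) simp
    then show "c + \<epsilon> *\<^sub>R v \<in> R"
      using \<open>S \<subseteq> R\<close> by blast
  qed
  have "corner_region D c \<sigma> \<tau> = R"
    unfolding corner_region_def v_def [symmetric]
  proof (rule the_equality)
    fix R' assume R': "R' \<in> regions D \<and> (\<forall>\<^sub>F \<epsilon> in at_right 0. c + \<epsilon> *\<^sub>R v \<in> R')"
    then have "\<forall>\<^sub>F \<epsilon> in at_right 0. c + \<epsilon> *\<^sub>R v \<in> R' \<and> c + \<epsilon> *\<^sub>R v \<in> R"
      using ev by (simp add: eventually_conj_iff)
    then have "\<exists>\<epsilon>. c + \<epsilon> *\<^sub>R v \<in> R' \<and> c + \<epsilon> *\<^sub>R v \<in> R"
      by (rule eventually_happens' [OF trivial_limit_at_right_real])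
    then have "R' \<inter> R \<noteq> {}"
      by blast
    then show "R' = R"
      using R R' unfolding regions_def by (meson components_eq)
  qed (use R ev in auto)
  moreover have "region_index D R = k"
    using region_index_winding_number [OF R, of p] \<open>p \<in> S\<close> \<open>S \<subseteq> R\<close> \<delta> [of "\<delta> / 2"] \<open>\<delta> > 0\<close>
    by (auto simp: p_def)
  ultimately show ?thesis
    using k by (simp add: v_def)
qed

text \<open>
  A corner may be probed in any direction between the two strands, not only in the direction of the
  sum of the given tangents: the observed winding number is locally constant in the direction,
  and the open sector is connected.  This is needed because an isotopy and a reparametrization
  rescale the two tangents by different factors.
\<close>

lemma germ_index_sector:
  assumes c: "c \<in> crossings D" and "\<sigma> \<noteq> 0" "\<tau> \<noteq> 0" "a > 0" "b > 0"
    and k: "germ_index D c (\<sigma> *\<^sub>R over_dir D c + \<tau> *\<^sub>R under_dir D c) k"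
  shows "germ_index D c ((a * \<sigma>) *\<^sub>R over_dir D c + (b * \<tau>) *\<^sub>R under_dir D c) k"
proof -
  define v where "v = (\<lambda>(a, b). (a * \<sigma>) *\<^sub>R over_dir D c + (b * \<tau>) *\<^sub>R under_dir D c)"
  define A where "A = {0::real<..} \<times> {0::real<..}"
  define K where "K = (\<lambda>p. THE k. germ_index D c (v p) k)"
  have ex: "\<exists>k. germ_index D c (v p) k" if "p \<in> A" for p
    using germ_index_exists [OF c] sector_direction [OF c, of "fst p * \<sigma>" "snd p * \<tau>" "v p"] that
      \<open>\<sigma> \<noteq> 0\<close> \<open>\<tau> \<noteq> 0\<close> by (auto simp: A_def v_def)
  have K_eq: "K p = k" if "germ_index D c (v p) k" for p k
    unfolding K_def using that germ_index_unique by blast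
  have K: "germ_index D c (v p) (K p)" if "p \<in> A" for p
    using ex that K_eq by metis
  have cont: "continuous_on A v"
    unfolding v_def case_prod_beta by (intro continuous_intros)
  have "K (1, 1) = K (a, b)"
  proof (rule connected_local_const [of A])
    show "connected A"
      unfolding A_def by (intro convex_connected convex_Times) auto
    show "\<forall>p\<in>A. \<forall>\<^sub>F q in at p within A. K p = K q"
    proof
      fix p assume "p \<in> A"
      obtain \<delta> where "\<delta> > 0" and \<delta>: "\<And>\<epsilon> w. 0 < \<epsilon> \<Longrightarrow> \<epsilon> < \<delta> \<Longrightarrow> dist w (v p) < \<delta> \<Longrightarrow>
            c + \<epsilon> *\<^sub>R w \<notin> path_image (curve D) \<and>
            winding_number (curve D) (c + \<epsilon> *\<^sub>R w) = of_int (K p)"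
        using K [OF \<open>p \<in> A\<close>] unfolding germ_index_def by metis
      have "(v \<longlongrightarrow> v p) (at p within A)"
        using cont \<open>p \<in> A\<close> by (simp add: continuous_on_def)
      then have "\<forall>\<^sub>F q in at p within A. dist (v q) (v p) < \<delta>"
        using \<open>\<delta> > 0\<close> by (rule tendstoD)
      then show "\<forall>\<^sub>F q in at p within A. K p = K q"
      proof eventually_elim
        case (elim q)
        define \<delta>' where "\<delta>' = \<delta> - dist (v q) (v p)"
        have "dist w (v p) < \<delta>" if "dist w (v q) < \<delta>'" for w
          using that dist_triangle [of w "v p" "v q"] by (simp add: \<delta>'_def)
        moreover have "0 < \<delta>'" "\<delta>' \<le> \<delta>"
          using elim by (auto simp: \<delta>'_def)
        ultimately have "germ_index D c (v q) (K p)"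
          unfolding germ_index_def using \<delta> by (intro exI [of _ \<delta>']) auto
        then show "K p = K q"
          using K_eq by metis
      qed
    qed
  qed (use assms in \<open>auto simp: A_def\<close>)
  moreover have "K (1, 1) = k"
    using k by (intro K_eq) (simp add: v_def)
  ultimately show ?thesis
    using K [of "(a, b)"] assms by (simp add: v_def A_def)
qed

end

text \<open>
  The image of a segment leaving \<open>c\<close> into a corner leaves \<open>h c\<close> in the direction given by the
  derivative, which lies inside the corresponding corner at \<open>h c\<close>.  Since \<open>h\<close> preserves winding
  numbers pointwise, the indices of the two corners agree.
\<close>

lemma germ_index_transport:
  assumes D: "knot_diagram D" and E: "knot_diagram E"
    and c: "c \<in> crossings D" and hc: "h c \<in> crossings E"
    and L: "(h has_derivative L) (at c)"
    and wind: "\<And>p. p \<notin> path_image (curve D) \<Longrightarrow>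
          winding_number (curve E) (h p) = winding_number (curve D) p"
    and pos: "0 < a" "0 < b"
    and over: "over_dir E (h c) = a *\<^sub>R L (over_dir D c)"
    and under: "under_dir E (h c) = b *\<^sub>R L (under_dir D c)"
    and "\<sigma> \<noteq> 0" "\<tau> \<noteq> 0"
  shows "region_index E (corner_region E (h c) \<sigma> \<tau>) = region_index D (corner_region D c \<sigma> \<tau>)"
proof -
  define k where "k = region_index D (corner_region D c \<sigma> \<tau>)"
  define l where "l = region_index E (corner_region E (h c) \<sigma> \<tau>)"
  define v where "v = \<sigma> *\<^sub>R over_dir D c + \<tau> *\<^sub>R under_dir D c"
  have lin: "bounded_linear L"
    using L by (rule has_derivative_bounded_linear)
  have Lv: "L v = (1 / a * \<sigma>) *\<^sub>R over_dir E (h c) + (1 / b * \<tau>) *\<^sub>R under_dir E (h c)"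
    using pos linear_add [OF bounded_linear.linear [OF lin]] linear_scale [OF bounded_linear.linear [OF lin]]
    by (simp add: v_def over under)
  have germ_D: "germ_index D c v k"
    unfolding v_def k_def using germ_index_corner_region [OF D c] assms by blast
  have germ_E: "germ_index E (h c) (L v) l"
    unfolding Lv l_def using pos assms
    by (intro germ_index_sector [OF E hc] germ_index_corner_region [OF E hc]) auto
  \<comment> \<open>The direction in which \<open>h (c + \<epsilon> *\<^sub>R v)\<close> is seen from \<open>h c\<close>.\<close>
  define w where "w = (\<lambda>\<epsilon>. (h (c + \<epsilon> *\<^sub>R v) - h c) /\<^sub>R \<epsilon>)"
  have "((\<lambda>x. h (c + x *\<^sub>R v)) has_derivative (\<lambda>x. L (x *\<^sub>R v))) (at 0)"
    by (rule has_derivative_compose [where f = "\<lambda>x. c + x *\<^sub>R v", simplified])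
       (auto intro!: derivative_eq_intros L)
  then have "((\<lambda>x. (h (c + x *\<^sub>R v) - h c - L (x *\<^sub>R v)) /\<^sub>R norm x) \<longlongrightarrow> 0) (at_right 0)"
    using has_derivative_at_withinI [of _ _ 0 "{0<..}"] unfolding has_derivative_at_within by fastforce
  moreover have "\<forall>\<^sub>F x in at_right 0.
      (h (c + x *\<^sub>R v) - h c - L (x *\<^sub>R v)) /\<^sub>R norm x = w x - L v"
    using eventually_at_right_less [of "0::real"]
    by eventually_elim
      (simp add: w_def linear_scale [OF bounded_linear.linear [OF lin]] scaleR_diff_right)
  ultimately have "((\<lambda>x. w x - L v) \<longlongrightarrow> 0) (at_right 0)"
    using tendsto_cong by fastforce
  then have "(w \<longlongrightarrow> L v) (at_right 0)"
    by (simp add: LIM_zero_iff)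
  from germ_index_eventually [OF germ_E this]
  have "\<forall>\<^sub>F \<epsilon> in at_right 0. winding_number (curve E) (h c + \<epsilon> *\<^sub>R w \<epsilon>) = of_int l"
    by eventually_elim simp
  moreover have "\<forall>\<^sub>F \<epsilon> in at_right (0::real). \<epsilon> > 0"
    by (rule eventually_at_right_less)
  moreover have "\<forall>\<^sub>F \<epsilon> in at_right 0. c + \<epsilon> *\<^sub>R v \<notin> path_image (curve D) \<and>
           winding_number (curve D) (c + \<epsilon> *\<^sub>R v) = of_int k"
    using germ_index_eventually [OF germ_D tendsto_const] .
  ultimately have "\<forall>\<^sub>F \<epsilon> in at_right (0::real). k = l"
  proof eventually_elim
    case (elim \<epsilon>)
    then have "h c + \<epsilon> *\<^sub>R w \<epsilon> = h (c + \<epsilon> *\<^sub>R v)"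
      by (simp add: w_def)
    then have "(of_int k :: complex) = of_int l"
      using elim wind by metis
    then show "k = l"
      by simp
  qed
  then show ?thesis
    by (simp add: k_def l_def)
qed

section \<open>Invariance under isotopy and reparametrization\<close>

context
  fixes \<phi> :: "real \<Rightarrow> real"
  assumes \<phi>: "circle_reparametrization \<phi>"
begin

lemma reparametrization_has_vector_derivative:
  "(\<phi> has_vector_derivative vector_derivative \<phi> (at t)) (at t)"
  using \<phi> smooth_map_has_vector_derivative unfolding circle_reparametrization_def by blast

lemma reparametrization_continuous_on: "continuous_on T \<phi>"
  using reparametrization_has_vector_derivative continuous_at_imp_continuous_on
    has_vector_derivative_continuous by blast

lemma reparametrization_strict_mono: "strict_mono \<phi>"
proof (rule strict_monoI)
  fix x y :: real assume "x < y"
  then show "\<phi> x < \<phi> y"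
  proof (rule DERIV_pos_imp_increasing)
    fix t
    have "vector_derivative \<phi> (at t) > 0"
      using \<phi> by (simp add: circle_reparametrization_def)
    then show "\<exists>d. DERIV \<phi> t :> d \<and> d > 0"
      using reparametrization_has_vector_derivative has_real_derivative_iff_has_vector_derivative
      by blast
  qed
qed

lemma reparametrization_add_int: "\<phi> (t + of_int n) = \<phi> t + of_int n"
  using periodic_int [of "\<lambda>t. \<phi> t - t" t n] \<phi> by (simp add: circle_reparametrization_def)

lemma reparametrization_diff_Ints_iff: "\<phi> s - \<phi> t \<in> \<int> \<longleftrightarrow> s - t \<in> \<int>"
proof
  assume "\<phi> s - \<phi> t \<in> \<int>"
  then obtain n where "\<phi> s - \<phi> t = of_int n"
    by (metis Ints_cases)
  then have "\<phi> s = \<phi> (t + of_int n)"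
    by (simp add: reparametrization_add_int)
  then have "s = t + of_int n"
    using reparametrization_strict_mono by (simp add: strict_mono_eq)
  then show "s - t \<in> \<int>"
    by simp
next
  assume "s - t \<in> \<int>"
  then obtain n where "s - t = of_int n"
    by (metis Ints_cases)
  then have "s = t + of_int n"
    by simp
  then show "\<phi> s - \<phi> t \<in> \<int>"
    by (simp add: reparametrization_add_int)
qed

lemma reparametrization_surj: "\<exists>t. \<phi> t = y"
proof -
  define n where "n = \<lfloor>y - \<phi> 0\<rfloor>"
  have "\<phi> (of_int n) = \<phi> 0 + of_int n" "\<phi> (of_int (n + 1)) = \<phi> 0 + of_int (n + 1)"
    using reparametrization_add_int [of 0 n] reparametrization_add_int [of 0 "n + 1"]
    by simp_all
  moreover have "of_int n \<le> y - \<phi> 0" "y - \<phi> 0 \<le> of_int (n + 1)"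
    unfolding n_def by linarith+
  ultimately have "\<phi> (of_int n) \<le> y" "y \<le> \<phi> (of_int (n + 1))"
    by linarith+
  then show ?thesis
    using IVT' [of \<phi> "of_int n" y "of_int (n + 1)"] reparametrization_continuous_on by auto
qed

end

lemma cross2_linear:
  assumes "linear L"
  shows "cross2 (L u) (L v) = cross2 (L 1) (L \<i>) * cross2 u v"
proof -
  have "L z = Re z *\<^sub>R L 1 + Im z *\<^sub>R L \<i>" for z
  proof -
    have "z = Re z *\<^sub>R 1 + Im z *\<^sub>R \<i>"
      by (simp add: complex_eq_iff)
    then have "L z = L (Re z *\<^sub>R 1 + Im z *\<^sub>R \<i>)"
      by (rule arg_cong)
    then show ?thesis
      by (simp only: linear_add [OF assms] linear_scale [OF assms])
  qed
  from this [of u] this [of v] show ?thesis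
    by (simp add: cross2_def algebra_simps)
qed

text \<open>
  The Jacobian determinant is 1 at time 0, depends continuously on time and never vanishes.
\<close>

lemma plane_isotopy_orientation_preserving:
  assumes H: "plane_isotopy H"
  obtains L where "(H 1 has_derivative L) (at z)" "cross2 (L 1) (L \<i>) > 0"
proof -
  obtain H' :: "real \<Rightarrow> complex \<Rightarrow> complex \<Rightarrow>\<^sub>L complex"
    where H': "\<And>s z. s \<in> {0..1} \<Longrightarrow> (H s has_derivative blinfun_apply (H' s z)) (at z)"
      and bij: "\<And>s z. s \<in> {0..1} \<Longrightarrow> bij (blinfun_apply (H' s z))"
      and cont: "continuous_on ({0..1} \<times> UNIV) (\<lambda>(s, z). H' s z)"
    using H unfolding plane_isotopy_def by blast
  define d where "d = (\<lambda>s. cross2 (H' s z 1) (H' s z \<i>))"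
  have "continuous_on {0..1} (\<lambda>s. H' s z)"
    by (rule continuous_on_compose2 [OF cont, where f = "\<lambda>s. (s, z)", simplified])
      (auto intro!: continuous_intros)
  then have cont_d: "continuous_on {0..1} d"
    unfolding d_def cross2_def by (intro continuous_intros)
  have "d s \<noteq> 0" if s: "s \<in> {0..1}" for s
  proof
    assume "d s = 0"
    obtain u v where "H' s z u = 1" "H' s z v = \<i>"
      using bij [OF s] by (metis bij_pointE)
    moreover have "linear (blinfun_apply (H' s z))"
      by (simp add: blinfun.bounded_linear_right bounded_linear.linear)
    ultimately have "cross2 1 \<i> = d s * cross2 u v"
      unfolding d_def using cross2_linear by metis
    then show False
      using \<open>d s = 0\<close> by (simp add: cross2_def)
  qed
  moreover have "d 0 = 1"
  proof -
    have "H 0 = (\<lambda>z. z)"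
      using H by (auto simp: plane_isotopy_def)
    then have "((\<lambda>z. z) has_derivative blinfun_apply (H' 0 z)) (at z)"
      using H' [of 0 z] by simp
    then have "blinfun_apply (H' 0 z) = (\<lambda>h. h)"
      using has_derivative_ident by (rule has_derivative_unique)
    then show ?thesis
      by (simp add: d_def cross2_def)
  qed
  ultimately have "d 1 > 0"
    using IVT2' [of d 1 0 0] cont_d by force
  then show thesis
    using that H' [of 1 z] by (simp add: d_def)
qed

text \<open>
  Moving the observer along with the isotopy, while the parametrization is deformed linearly from
  the identity to \<open>\<phi>\<close>, gives a free homotopy of loops that never meets the observer, because each
  stage of the isotopy is injective.  Periodicity keeps the intermediate curves closed although
  their base point moves.
\<close>

lemma winding_number_isotopy:
  fixes \<gamma> :: "real \<Rightarrow> complex"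
  assumes H: "plane_isotopy H" and \<phi>: "circle_reparametrization \<phi>"
    and cont: "continuous_on UNIV \<gamma>" and per: "\<And>t. \<gamma> (t + 1) = \<gamma> t" and p: "p \<notin> range \<gamma>"
  shows "winding_number (H 1 \<circ> \<gamma> \<circ> \<phi>) (H 1 p) = winding_number \<gamma> p"
proof -
  define h where "h = (\<lambda>(s, t). H s (\<gamma> ((1 - s) * t + s * \<phi> t)) - H s p)"
  define q where "q = (\<lambda>x :: real \<times> real. (1 - fst x) * snd x + fst x * \<phi> (snd x))"
  have contH: "continuous_on ({0..1} \<times> UNIV) (\<lambda>(s, z). H s z)"
    and bij: "\<And>s. s \<in> {0..1} \<Longrightarrow> bij (H s)" and H0: "\<And>z. H 0 z = z"
    using H by (auto simp: plane_isotopy_def)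
  have "continuous_on ({0..1} \<times> {0..1}) (\<lambda>x. \<phi> (snd x))"
    by (rule continuous_on_compose2 [OF reparametrization_continuous_on [OF \<phi>, of UNIV]])
       (auto intro!: continuous_intros)
  then have cont_q: "continuous_on ({0..1} \<times> {0..1}) q"
    unfolding q_def by (intro continuous_intros)
  have "continuous_on ({0..1} \<times> {0..1}) (\<lambda>x. (fst x, \<gamma> (q x)))"
    by (intro continuous_on_Pair continuous_on_compose2 [OF cont cont_q] continuous_intros) auto
  then have "continuous_on ({0..1} \<times> {0..1}) (\<lambda>x. H (fst x) (\<gamma> (q x)))"
    using continuous_on_compose2 [OF contH, of "{0..1} \<times> {0..1}" "\<lambda>x. (fst x, \<gamma> (q x))"]
    by (auto simp: image_subset_iff)
  moreover have "continuous_on ({0..1} \<times> {0..1::real}) (\<lambda>x. (fst x, p))"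
    by (intro continuous_intros)
  then have "continuous_on ({0..1} \<times> {0..1::real}) (\<lambda>x. H (fst x) p)"
    using continuous_on_compose2 [OF contH, of "{0..1} \<times> {0..1::real}" "\<lambda>x. (fst x, p)"]
    by (auto simp: image_subset_iff)
  ultimately have cont_h: "continuous_on ({0..1} \<times> {0..1}) h"
    unfolding h_def case_prod_beta q_def by (rule continuous_on_diff)
  have "homotopic_loops (- {0}) (\<lambda>t. \<gamma> t - p) (\<lambda>t. (H 1 \<circ> \<gamma> \<circ> \<phi>) t - H 1 p)"
    unfolding homotopic_loops
  proof (intro exI [of _ h] conjI ballI cont_h)
    show "h \<in> {0..1} \<times> {0..1} \<rightarrow> - {0}"
    proof
      fix x :: "real \<times> real" assume x: "x \<in> {0..1} \<times> {0..1}"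
      have "inj (H (fst x))"
        using bij x by (auto intro: bij_is_inj)
      then show "h x \<in> - {0}"
        using p by (auto simp: h_def case_prod_beta inj_eq)
    qed
  next
    fix s :: real
    have "\<phi> 1 = \<phi> 0 + 1"
      using \<phi> by (metis add.left_neutral circle_reparametrization_def)
    then have "(1 - s) * 1 + s * \<phi> 1 = ((1 - s) * 0 + s * \<phi> 0) + 1"
      by (simp add: algebra_simps)
    then show "pathfinish (h \<circ> Pair s) = pathstart (h \<circ> Pair s)"
      unfolding pathfinish_def pathstart_def h_def o_def prod.case by (simp only: per)
  qed (auto simp: h_def H0)
  then have "winding_number (\<lambda>t. \<gamma> t - p) 0 = winding_number (\<lambda>t. (H 1 \<circ> \<gamma> \<circ> \<phi>) t - H 1 p) 0"
    by (rule winding_number_homotopic_loops)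
  then show ?thesis
    by (simp only: winding_number_offset [symmetric])
qed

lemma SCI_diagram_invariant: "diagram_invariant SCI"
  unfolding diagram_invariant_def
proof (intro allI impI)
  fix D E assume D: "knot_diagram D" and E: "knot_diagram E" and "same_diagram D E"
  then obtain H \<phi> where H: "plane_isotopy H" and \<phi>: "circle_reparametrization \<phi>"
    and curve_E: "curve E = H 1 \<circ> curve D \<circ> \<phi>" and over_E: "over E = \<phi> -` over D"
    unfolding same_diagram_def by blast
  define h where "h = H 1"
  have "inj h"
    using H by (auto simp: h_def plane_isotopy_def bij_is_inj)
  have curve_E_eq: "curve E t = h (curve D (\<phi> t))" for t
    by (simp add: curve_E h_def)
  have double_E: "double_pair E s t \<longleftrightarrow> double_pair D (\<phi> s) (\<phi> t)" for s t
    using \<open>inj h\<close> reparametrization_diff_Ints_iff [OF \<phi>]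
    by (simp add: double_pair_def curve_E_eq inj_eq)
  have crossings_E: "crossings E = h ` crossings D"
  proof (intro set_eqI iffI)
    fix c' assume "c' \<in> crossings E"
    then show "c' \<in> h ` crossings D"
      by (auto simp: crossings_def double_E curve_E_eq)
  next
    fix c' assume "c' \<in> h ` crossings D"
    then obtain s t where "double_pair D s t" "c' = h (curve D s)"
      by (auto simp: crossings_def)
    moreover obtain s' t' where "\<phi> s' = s" "\<phi> t' = t"
      using reparametrization_surj [OF \<phi>] by metis
    ultimately show "c' \<in> crossings E"
      unfolding crossings_def using double_E curve_E_eq by blast
  qed
  have winding: "winding_number (curve E) (h p) = winding_number (curve D) p"
    if "p \<notin> path_image (curve D)" for p
    unfolding curve_E h_def using that D path_image_curve [OF D]
    by (intro winding_number_isotopy H \<phi> continuous_on_curve) (auto simp: knot_diagram_def)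
  have tangent_E: "tangent E t = vector_derivative \<phi> (at t) *\<^sub>R L (tangent D (\<phi> t))"
    if L: "(h has_derivative L) (at (curve D (\<phi> t)))" for L t
  proof -
    have "linear L"
      using L has_derivative_bounded_linear bounded_linear.linear by blast
    have "((curve D \<circ> \<phi>) has_vector_derivative vector_derivative \<phi> (at t) *\<^sub>R tangent D (\<phi> t)) (at t)"
      by (intro vector_diff_chain_at reparametrization_has_vector_derivative [OF \<phi>]
          curve_has_vector_derivative [OF D])
    then have "((\<lambda>x. h ((curve D \<circ> \<phi>) x)) has_derivative
        (\<lambda>x. L (x *\<^sub>R vector_derivative \<phi> (at t) *\<^sub>R tangent D (\<phi> t)))) (at t)"
      unfolding has_vector_derivative_def by (rule has_derivative_compose) (simp add: L)
    then have "(curve E has_vector_derivative vector_derivative \<phi> (at t) *\<^sub>R L (tangent D (\<phi> t))) (at t)"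
      by (simp add: has_vector_derivative_def curve_E h_def o_def linear_scale [OF \<open>linear L\<close>])
    then show ?thesis
      using vector_derivative_at unfolding tangent_def by blast
  qed
  have "crossing_sign E (h c) * crossing_index E (h c) = crossing_sign D c * crossing_index D c"
    if c: "c \<in> crossings D" for c
  proof -
    obtain L where L: "(h has_derivative L) (at c)" and det: "cross2 (L 1) (L \<i>) > 0"
      using plane_isotopy_orientation_preserving [OF H] unfolding h_def by metis
    have "linear L"
      using L has_derivative_bounded_linear bounded_linear.linear by blast
    have hc: "h c \<in> crossings E"
      using c crossings_E by simp
    obtain s t where st: "curve D s = c" "curve D t = c" "s \<in> over D" "t \<notin> over D"
      using crossing_parameters [OF D c] by metis
    obtain s' t' where st': "\<phi> s' = s" "\<phi> t' = t"
      using reparametrization_surj [OF \<phi>] by metis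
    define a where "a = vector_derivative \<phi> (at s')"
    define b where "b = vector_derivative \<phi> (at t')"
    have ab: "a > 0" "b > 0"
      using \<phi> by (simp_all add: a_def b_def circle_reparametrization_def)
    have over: "over_dir E (h c) = a *\<^sub>R L (over_dir D c)"
      using over_dir_eq_tangent [OF E, of s'] over_dir_eq_tangent [OF D, of s] tangent_E [of L s']
        st st' L c hc by (simp add: curve_E_eq over_E a_def)
    have under: "under_dir E (h c) = b *\<^sub>R L (under_dir D c)"
      using under_dir_eq_tangent [OF E, of t'] under_dir_eq_tangent [OF D, of t] tangent_E [of L t']
        st st' L c hc by (simp add: curve_E_eq over_E b_def)
    have "crossing_sign E (h c) = crossing_sign D c"
      using ab det cross2_linear [OF \<open>linear L\<close>, of "over_dir D c" "under_dir D c"]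
      by (simp add: crossing_sign_def over under cross2_algebra sgn_mult)
    moreover have "region_index E (corner_region E (h c) \<sigma> \<tau>) = region_index D (corner_region D c \<sigma> \<tau>)"
      if "\<sigma> \<noteq> 0" "\<tau> \<noteq> 0" for \<sigma> \<tau>
      using germ_index_transport [OF D E c hc L winding ab over under that] by blast
    then have "crossing_index E (h c) = crossing_index D c"
      by (simp add: crossing_index_def)
    ultimately show ?thesis
      by simp
  qed
  moreover have "SCI E = (\<Sum>c\<in>crossings D. crossing_sign E (h c) * crossing_index E (h c))"
    unfolding SCI_def crossings_E using \<open>inj h\<close>
    by (subst sum.reindex) (auto intro: inj_on_subset simp: o_def)
  ultimately show "SCI D = SCI E"
    by (simp add: SCI_def)
qed

section \<open>The limacon\<close>

abbreviation unit_circle :: "real \<Rightarrow> complex" where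
  "unit_circle \<equiv> circlepath 0 1"

lemma unit_circle_has_vector_derivative:
  "(unit_circle has_vector_derivative 2 * of_real pi * \<i> * unit_circle t) (at t)"
  using has_vector_derivative_circlepath [of 0 1 t UNIV] by (simp add: circlepath)

lemma norm_unit_circle [simp]: "norm (unit_circle t) = 1"
  by (simp add: circlepath)

lemma unit_circle_eq_iff: "unit_circle s = unit_circle t \<longleftrightarrow> s - t \<in> \<int>"
proof -
  have "unit_circle s = unit_circle t \<longleftrightarrow>
      (\<exists>n::int. 2 * of_real pi * \<i> * of_real s = 2 * of_real pi * \<i> * of_real t + (of_int (2 * n) * pi) * \<i>)"
    by (simp add: circlepath exp_eq)
  also have "\<dots> \<longleftrightarrow> (\<exists>n::int. s - t = of_int n)"
  proof (rule ex_cong1)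
    fix n :: int
    have "2 * of_real pi * \<i> * of_real t + (of_int (2 * n) * pi) * \<i> =
        2 * of_real pi * \<i> * of_real (t + of_int n)"
      by (simp add: algebra_simps)
    then have "2 * of_real pi * \<i> * of_real s = 2 * of_real pi * \<i> * of_real t + (of_int (2 * n) * pi) * \<i>
        \<longleftrightarrow> s = t + of_int n"
      by (simp only: mult_cancel_left of_real_eq_iff) simp
    then show "2 * of_real pi * \<i> * of_real s = 2 * of_real pi * \<i> * of_real t + (of_int (2 * n) * pi) * \<i>
        \<longleftrightarrow> s - t = of_int n"
      by auto
  qed
  finally show ?thesis
    by (auto simp: Ints_def)
qed

lemma unit_circle_surj:
  assumes "norm z = 1"
  obtains t where "unit_circle t = z"
proof -
  have "z \<in> path_image unit_circle"
    using assms by simp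
  then show thesis
    using that by (auto simp: path_image_def)
qed

text \<open>
  The primitive third root of unity in the upper half plane.
\<close>

definition omega :: complex where
  "omega = Complex (- 1 / 2) (sqrt 3 / 2)"

lemma omega_simps:
  "norm omega = 1" "omega\<^sup>2 + omega = - 1" "(cnj omega)\<^sup>2 + cnj omega = - 1" "omega \<noteq> cnj omega"
  by (simp_all add: omega_def cmod_def complex_eq_iff power2_eq_square)

text \<open>
  A limacon, the image of the unit circle under the polynomial \<open>z\<^sup>2 + z\<close>.  The polynomial
  identifies exactly the two points \<open>omega\<close> and \<open>cnj omega\<close> of the circle, and the winding number
  around \<open>w\<close> counts the solutions of \<open>z\<^sup>2 + z = w\<close> in the unit disc.
\<close>

definition limacon :: diagram where
  "limacon = \<lparr>curve = \<lambda>t. (unit_circle t)\<^sup>2 + unit_circle t, over = {t. unit_circle t = omega}\<rparr>"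

lemma curve_limacon: "curve limacon t = (unit_circle t)\<^sup>2 + unit_circle t"
  by (simp add: limacon_def)

lemma over_limacon: "t \<in> over limacon \<longleftrightarrow> unit_circle t = omega"
  by (simp add: limacon_def)

text \<open>
  If \<open>z\<^sup>2 + z = w\<^sup>2 + w\<close> with \<open>z \<noteq> w\<close>, then \<open>z + w = - 1\<close>; on the unit circle this leaves only the two
  primitive third roots of unity.
\<close>

lemma limacon_sum_minus_1:
  assumes "norm z = 1" "norm w = 1" "z + w = - 1"
  shows "z = omega \<and> w = cnj omega \<or> z = cnj omega \<and> w = omega"
proof -
  have re: "Re w = - 1 - Re z" and im: "Im w = - Im z"
    using assms(3) by (simp_all add: complex_eq_iff)
  have n: "(Re z)\<^sup>2 + (Im z)\<^sup>2 = 1" "(Re w)\<^sup>2 + (Im w)\<^sup>2 = 1"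
    using assms cmod_power2 [of z] cmod_power2 [of w] by simp_all
  then have "Re z = - 1 / 2"
    unfolding re im by (simp add: power2_eq_square algebra_simps)
  moreover from this have "(Im z)\<^sup>2 = (sqrt 3 / 2)\<^sup>2"
    using n(1) by (simp add: power2_eq_square)
  then have "Im z = sqrt 3 / 2 \<or> Im z = - (sqrt 3 / 2)"
    by (rule power2_eq_iff [THEN iffD1])
  ultimately show ?thesis
    using re im by (auto simp: omega_def complex_eq_iff)
qed

lemma double_pair_limacon:
  "double_pair limacon s t \<longleftrightarrow>
     unit_circle s = omega \<and> unit_circle t = cnj omega \<or>
     unit_circle s = cnj omega \<and> unit_circle t = omega"
proof -
  have "(unit_circle s)\<^sup>2 + unit_circle s - ((unit_circle t)\<^sup>2 + unit_circle t) =
      (unit_circle s - unit_circle t) * (unit_circle s + unit_circle t + 1)"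
    by (simp add: power2_eq_square algebra_simps)
  then have "double_pair limacon s t \<longleftrightarrow>
      unit_circle s \<noteq> unit_circle t \<and> unit_circle s + unit_circle t + 1 = 0"
    by (auto simp: double_pair_def limacon_def unit_circle_eq_iff [symmetric])
  also have "\<dots> \<longleftrightarrow> unit_circle s = omega \<and> unit_circle t = cnj omega \<or>
     unit_circle s = cnj omega \<and> unit_circle t = omega"
    using limacon_sum_minus_1 [of "unit_circle s" "unit_circle t"] omega_simps(4)
    by (auto simp: add_eq_0_iff2) (auto simp: omega_def complex_eq_iff)
  finally show ?thesis .
qed

lemma omega_parameters:
  obtains s t where "unit_circle s = omega" "unit_circle t = cnj omega"
  using unit_circle_surj [of omega] unit_circle_surj [of "cnj omega"] omega_simps(1)
  by (metis complex_mod_cnj)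

lemma crossings_limacon: "crossings limacon = {- 1}"
proof -
  obtain s t where st: "unit_circle s = omega" "unit_circle t = cnj omega"
    by (rule omega_parameters)
  show ?thesis
  proof
    show "crossings limacon \<subseteq> {- 1}"
      unfolding crossings_def double_pair_limacon
      using omega_simps(2,3) by (auto simp: limacon_def)
    have "double_pair limacon s t" "curve limacon s = - 1"
      using st omega_simps(2) by (simp_all add: double_pair_limacon) (simp add: limacon_def)
    then show "{- 1} \<subseteq> crossings limacon"
      unfolding crossings_def by blast
  qed
qed

lemma limacon_has_vector_derivative:
  "(curve limacon has_vector_derivative
     2 * of_real pi * \<i> * unit_circle t * (2 * unit_circle t + 1)) (at t)"
proof -
  have "((\<lambda>t. unit_circle t * unit_circle t + unit_circle t) has_vector_derivative
     2 * of_real pi * \<i> * unit_circle t * (2 * unit_circle t + 1)) (at t)"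
    using has_vector_derivative_add [OF has_vector_derivative_mult
        [OF unit_circle_has_vector_derivative unit_circle_has_vector_derivative]
        unit_circle_has_vector_derivative, of t]
    by (simp add: algebra_simps)
  then show ?thesis
    by (simp add: limacon_def power2_eq_square)
qed

lemma tangent_limacon:
  "tangent limacon t = 2 * of_real pi * \<i> * unit_circle t * (2 * unit_circle t + 1)"
  unfolding tangent_def by (rule vector_derivative_at [OF limacon_has_vector_derivative])

lemma tangent_limacon_omega:
  "unit_circle t = omega \<Longrightarrow> tangent limacon t = of_real pi * Complex (sqrt 3) (- 3)"
  "unit_circle t = cnj omega \<Longrightarrow> tangent limacon t = of_real pi * Complex (- sqrt 3) (- 3)"
proof -
  have "2 * of_real pi * \<i> * omega * (2 * omega + 1) = of_real pi * Complex (sqrt 3) (- 3)"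
    "2 * of_real pi * \<i> * cnj omega * (2 * cnj omega + 1) = of_real pi * Complex (- sqrt 3) (- 3)"
    by (simp_all add: omega_def complex_eq_iff algebra_simps)
  then show "unit_circle t = omega \<Longrightarrow> tangent limacon t = of_real pi * Complex (sqrt 3) (- 3)"
    "unit_circle t = cnj omega \<Longrightarrow> tangent limacon t = of_real pi * Complex (- sqrt 3) (- 3)"
    by (simp_all only: tangent_limacon)
qed

lemma smooth_map_limacon: "smooth_map (curve limacon)"
proof -
  \<comment> \<open>The circle parametrization and its square are eigenfunctions of differentiation.\<close>
  define F :: "nat \<Rightarrow> real \<Rightarrow> complex" where
    "F = (\<lambda>n t. (4 * of_real pi * \<i>) ^ n * (unit_circle t * unit_circle t) +
               (2 * of_real pi * \<i>) ^ n * unit_circle t)"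
  have "(F n has_vector_derivative F (Suc n) t) (at t)" for n t
    unfolding F_def
    using has_vector_derivative_add [OF
        has_vector_derivative_mult_right [OF has_vector_derivative_mult
          [OF unit_circle_has_vector_derivative unit_circle_has_vector_derivative]]
        has_vector_derivative_mult_right [OF unit_circle_has_vector_derivative],
        of "(4 * of_real pi * \<i>) ^ n" "(2 * of_real pi * \<i>) ^ n" t]
    by (simp add: algebra_simps)
  moreover have "F 0 = curve limacon"
    by (simp add: F_def limacon_def power2_eq_square fun_eq_iff)
  ultimately show ?thesis
    unfolding smooth_map_def by blast
qed

lemma knot_diagram_limacon: "knot_diagram limacon"
  unfolding knot_diagram_def
proof (intro conjI allI impI)
  show "smooth_map (curve limacon)"
    by (rule smooth_map_limacon)
  show "finite (crossings limacon)"
    by (simp add: crossings_limacon)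
  show "curve limacon (t + 1) = curve limacon t" for t
    by (simp add: limacon_def circlepath_add1)
  show "t + 1 \<in> over limacon \<longleftrightarrow> t \<in> over limacon" for t
    by (simp add: limacon_def circlepath_add1)
  show "tangent limacon t \<noteq> 0" for t
  proof
    assume "tangent limacon t = 0"
    then have "unit_circle t = 0 \<or> 2 * unit_circle t = - 1"
      by (auto simp: tangent_limacon add_eq_0_iff2)
    then have "norm (unit_circle t) = 0 \<or> norm (2 * unit_circle t) = 1"
      by (metis norm_minus_cancel norm_one norm_zero)
    then show False
      by (simp add: norm_mult)
  qed
  show "\<not> (double_pair limacon r s \<and> double_pair limacon s t \<and> double_pair limacon r t)" for r s t
    using omega_simps(4) by (auto simp: double_pair_limacon)
  show "cross2 (tangent limacon s) (tangent limacon t) \<noteq> 0" if "double_pair limacon s t" for s t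
    using that unfolding double_pair_limacon
    by (elim disjE conjE) (simp_all add: tangent_limacon_omega cross2_def)
  show "over limacon \<subseteq> {t. curve limacon t \<in> crossings limacon}"
  proof
    fix t assume "t \<in> over limacon"
    then have "curve limacon t = - 1"
      by (simp only: over_limacon curve_limacon omega_simps)
    then show "t \<in> {t. curve limacon t \<in> crossings limacon}"
      by (simp add: crossings_limacon)
  qed
  show "s \<in> over limacon \<longleftrightarrow> t \<notin> over limacon" if "double_pair limacon s t" for s t
    using that omega_simps(4) unfolding double_pair_limacon over_limacon by metis
qed

lemma limacon_directions:
  "over_dir limacon (- 1) = of_real pi * Complex (sqrt 3) (- 3)"
  "under_dir limacon (- 1) = of_real pi * Complex (- sqrt 3) (- 3)"
proof -
  obtain s t where st: "unit_circle s = omega" "unit_circle t = cnj omega"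
    by (rule omega_parameters)
  then have "curve limacon s = - 1" "curve limacon t = - 1" "s \<in> over limacon" "t \<notin> over limacon"
    using omega_simps by (auto simp: limacon_def)
  then show "over_dir limacon (- 1) = of_real pi * Complex (sqrt 3) (- 3)"
    "under_dir limacon (- 1) = of_real pi * Complex (- sqrt 3) (- 3)"
    using over_dir_eq_tangent [OF knot_diagram_limacon, of s]
      under_dir_eq_tangent [OF knot_diagram_limacon, of t] tangent_limacon_omega st
    by (simp_all add: crossings_limacon)
qed

lemma winding_number_unit_circle:
  assumes "norm a \<noteq> 1"
  shows "winding_number unit_circle a = (if norm a < 1 then 1 else 0)"
proof (cases "norm a < 1")
  case True
  then show ?thesis
    by (simp add: winding_number_circlepath)
next
  case False
  then show ?thesis
    using assms winding_number_zero_outside [of unit_circle "cball 0 1" a] by auto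
qed

text \<open>
  By partial fractions, the logarithmic derivative of \<open>z\<^sup>2 + z - w = (z - a) * (z - b)\<close> is the sum of
  those of the two factors, so the winding number is the number of roots in the open unit disc.
  One root lies there whenever \<open>norm w = norm a * norm b < 1\<close>.
\<close>

lemma winding_number_limacon:
  assumes w: "w \<notin> path_image (curve limacon)"
  obtains n :: nat where "winding_number (curve limacon) w = of_nat n" "norm w < 1 \<Longrightarrow> n > 0"
proof -
  \<comment> \<open>The solutions \<open>z\<close> of \<open>z\<^sup>2 + z = w\<close>.\<close>
  define a b where "a = (- 1 + csqrt (1 + 4 * w)) / 2" and "b = (- 1 - csqrt (1 + 4 * w)) / 2"
  have ab: "a + b = - 1"
    by (simp add: a_def b_def field_simps)
  have "4 * (a * b) = 1 - (csqrt (1 + 4 * w))\<^sup>2"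
    by (simp add: a_def b_def power2_eq_square field_simps)
  then have ab': "a * b = - w"
    by simp
  have factor: "z\<^sup>2 + z - w = (z - a) * (z - b)" for z
  proof -
    have "(z - a) * (z - b) = z\<^sup>2 - (a + b) * z + a * b"
      by (simp add: power2_eq_square algebra_simps)
    then show ?thesis
      by (simp add: ab ab')
  qed
  have off: "norm z \<noteq> 1" if "z = a \<or> z = b" for z
  proof
    assume "norm z = 1"
    then have "z \<in> path_image unit_circle"
      by simp
    then obtain t where t: "t \<in> {0..1}" "unit_circle t = z"
      by (auto simp: path_image_def)
    then have "curve limacon t = w"
      using that factor [of z] by (auto simp: limacon_def)
    then show False
      using w t by (auto simp: path_image_def)
  qed
  have ne: "unit_circle t \<noteq> a" "unit_circle t \<noteq> b" for t
    using off norm_unit_circle by metis+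
  define N where "N = (\<lambda>z. winding_number unit_circle z)"
  have log_deriv: "((\<lambda>t. (1 / (unit_circle t - z)) * vector_derivative unit_circle (at t)) has_integral
      (2 * pi * \<i> * N z)) {0..1}" if "z = a \<or> z = b" for z
    using has_contour_integral_winding_number [of unit_circle z] off [OF that]
    by (auto simp: has_contour_integral N_def)
  have "((\<lambda>t. (1 / (unit_circle t - a)) * vector_derivative unit_circle (at t) +
          (1 / (unit_circle t - b)) * vector_derivative unit_circle (at t)) has_integral
      (2 * pi * \<i> * N a + 2 * pi * \<i> * N b)) {0..1}"
    by (intro has_integral_add log_deriv) auto
  moreover have "(1 / (unit_circle t - a)) * vector_derivative unit_circle (at t) +
          (1 / (unit_circle t - b)) * vector_derivative unit_circle (at t) =
        (1 / (curve limacon t - w)) * vector_derivative (curve limacon) (at t)" for t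
  proof -
    have "1 / (unit_circle t - a) + 1 / (unit_circle t - b) =
        (2 * unit_circle t - (a + b)) / ((unit_circle t - a) * (unit_circle t - b))"
      using ne [of t] by (simp add: field_simps)
    also have "\<dots> = (2 * unit_circle t + 1) / (curve limacon t - w)"
      by (simp add: ab factor [symmetric] limacon_def)
    finally show ?thesis
      unfolding vector_derivative_at [OF unit_circle_has_vector_derivative]
        vector_derivative_at [OF limacon_has_vector_derivative] distrib_right [symmetric]
      by simp
  qed
  ultimately have "((\<lambda>z. 1 / (z - w)) has_contour_integral (2 * pi * \<i> * (N a + N b))) (curve limacon)"
    by (simp add: has_contour_integral algebra_simps)
  then have "contour_integral (curve limacon) (\<lambda>z. 1 / (z - w)) = 2 * pi * \<i> * (N a + N b)"
    by (rule contour_integral_unique)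
  moreover have "valid_path (curve limacon)"
  proof -
    have "valid_path ((\<lambda>z. z\<^sup>2 + z) \<circ> unit_circle)"
      by (rule valid_path_compose_holomorphic [where S = UNIV]) (auto intro!: holomorphic_intros)
    then show ?thesis
      by (simp add: limacon_def o_def)
  qed
  ultimately have wind: "winding_number (curve limacon) w = N a + N b"
    using winding_number_valid_path [OF _ w] by simp
  define n :: nat where "n = (if norm a < 1 then 1 else 0) + (if norm b < 1 then 1 else 0)"
  show thesis
  proof
    show "winding_number (curve limacon) w = of_nat n"
      using wind winding_number_unit_circle [of a] winding_number_unit_circle [of b] off
      by (auto simp: N_def n_def)
  next
    assume "norm w < 1"
    moreover have "norm a * norm b = norm w"
      by (metis ab' norm_minus_cancel norm_mult)
    ultimately have "norm a < 1 \<or> norm b < 1"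
      by (metis linorder_not_le mult_mono' mult_1 norm_ge_zero zero_le_one)
    then show "n > 0"
      by (auto simp: n_def)
  qed
qed

text \<open>
  Winding numbers of the limacon are never negative, which bounds all corners.  The corner between
  the over direction and the reverse of the under direction contains points just to the right of
  the crossing \<open>- 1\<close>, which lie in the open unit disc, so its index is positive.
\<close>

lemma limacon_corner_index:
  assumes "\<sigma> \<in> {1, - 1}" "\<tau> \<in> {1, - 1}"
  shows "region_index limacon (corner_region limacon (- 1) \<sigma> \<tau>) \<ge> 0"
    and "\<sigma> = 1 \<Longrightarrow> \<tau> = - 1 \<Longrightarrow> region_index limacon (corner_region limacon (- 1) \<sigma> \<tau>) > 0"
proof -
  define k where "k = region_index limacon (corner_region limacon (- 1) \<sigma> \<tau>)"
  define v where "v = \<sigma> *\<^sub>R over_dir limacon (- 1) + \<tau> *\<^sub>R under_dir limacon (- 1)"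
  have "germ_index limacon (- 1) v k"
    unfolding v_def k_def using assms
    by (intro germ_index_corner_region knot_diagram_limacon) (auto simp: crossings_limacon)
  from germ_index_eventually [OF this tendsto_const]
  have ev: "\<forall>\<^sub>F \<epsilon> in at_right 0. - 1 + \<epsilon> *\<^sub>R v \<notin> path_image (curve limacon) \<and>
           winding_number (curve limacon) (- 1 + \<epsilon> *\<^sub>R v) = of_int k" .
  then obtain \<epsilon> where \<epsilon>: "- 1 + \<epsilon> *\<^sub>R v \<notin> path_image (curve limacon)"
      "winding_number (curve limacon) (- 1 + \<epsilon> *\<^sub>R v) = of_int k"
    using eventually_happens' [OF trivial_limit_at_right_real ev] by blast
  obtain n where "winding_number (curve limacon) (- 1 + \<epsilon> *\<^sub>R v) = of_nat n"
    using winding_number_limacon [OF \<epsilon>(1)] by metis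
  then have "k = int n"
    using \<epsilon>(2) by (metis of_int_eq_iff of_int_of_nat_eq)
  then show "k \<ge> 0"
    by simp
  assume "\<sigma> = 1" "\<tau> = - 1"
  then have v: "v = of_real (2 * pi * sqrt 3)"
    by (simp add: v_def limacon_directions complex_eq_iff algebra_simps)
  \<comment> \<open>On this range the point \<open>- 1 + \<epsilon> *\<^sub>R v\<close> lies strictly between \<open>- 1\<close> and 0.\<close>
  have "\<forall>\<^sub>F \<epsilon> in at_right (0::real). 0 < \<epsilon> \<and> \<epsilon> < 1 / (2 * pi * sqrt 3)"
    unfolding eventually_at_right_field by (intro exI [of _ "1 / (2 * pi * sqrt 3)"]) simp
  then have "\<forall>\<^sub>F \<epsilon> in at_right (0::real). (0 < \<epsilon> \<and> \<epsilon> < 1 / (2 * pi * sqrt 3)) \<and>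
     - 1 + \<epsilon> *\<^sub>R v \<notin> path_image (curve limacon) \<and>
     winding_number (curve limacon) (- 1 + \<epsilon> *\<^sub>R v) = of_int k"
    using ev by (rule eventually_conj)
  then obtain \<epsilon> where \<epsilon>: "0 < \<epsilon>" "\<epsilon> < 1 / (2 * pi * sqrt 3)"
      "- 1 + \<epsilon> *\<^sub>R v \<notin> path_image (curve limacon)"
      "winding_number (curve limacon) (- 1 + \<epsilon> *\<^sub>R v) = of_int k"
    using eventually_happens' [OF trivial_limit_at_right_real] by blast
  have "- 1 + \<epsilon> *\<^sub>R v = of_real (- 1 + \<epsilon> * (2 * pi * sqrt 3))"
    by (simp add: v scaleR_conv_of_real)
  moreover have "0 < \<epsilon> * (2 * pi * sqrt 3)" "\<epsilon> * (2 * pi * sqrt 3) < 1"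
    using \<epsilon>(1,2) by (simp_all add: field_simps)
  ultimately have "norm (- 1 + \<epsilon> *\<^sub>R v) < 1"
    by (simp only: norm_of_real)
  then obtain n where "winding_number (curve limacon) (- 1 + \<epsilon> *\<^sub>R v) = of_nat n" "n > 0"
    using winding_number_limacon [OF \<epsilon>(3)] by metis
  then have "k = int n"
    using \<epsilon>(4) by (metis of_int_eq_iff of_int_of_nat_eq)
  then show "k > 0"
    using \<open>n > 0\<close> by simp
qed

lemma alternating_sum_SCI_limacon: "alternating_sum SCI limacon {- 1} \<noteq> 0"
proof -
  have "crossing_sign limacon (- 1) \<noteq> 0"
    using cross2_over_under [OF knot_diagram_limacon, of "- 1"]
    by (simp add: crossing_sign_def crossings_limacon sgn_zero_iff)
  moreover have "crossing_index limacon (- 1) > 0"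
    using limacon_corner_index(1) [of 1 1] limacon_corner_index(2) [of 1 "- 1"]
      limacon_corner_index(1) [of "- 1" 1] limacon_corner_index(1) [of "- 1" "- 1"]
    by (simp add: crossing_index_def)
  ultimately show ?thesis
    by (subst alternating_sum_SCI_singleton) (simp_all add: crossings_limacon)
qed

theorem theorem3p8:
  shows "diagram_invariant SCI \<and> vassiliev_order SCI 1"
proof
  show "diagram_invariant SCI"
    by (rule SCI_diagram_invariant)
  show "vassiliev_order SCI 1"
    unfolding vassiliev_order_def
  proof (intro conjI exI [of _ limacon] exI [of _ "{- 1}"])
    show "{- 1} \<subseteq> crossings limacon"
      by (simp add: crossings_limacon)
    show "vassiliev_order_at_most SCI 1"
      by (rule SCI_order_at_most_1)
  qed (simp_all add: knot_diagram_limacon alternating_sum_SCI_limacon)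
qed

end
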